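(* Let $k\ge 1$ be an integer, let $S\subset\{\infty,2,3,\dots\}$ be a set of $k$ coefficients, let $\mathcal F$ be the class of all defining graphs $\Gamma$ such that $m_{ab}\notin S$ for all distinct vertices $a,b$ of $\Gamma$, and let $A_{\mathcal F}$ be the corresponding family of Artin groups. Let $f:\mathbf N\to\mathbf N$ be a function, and let $\Gamma$ be a graph picked uniformly at random in $\mathcal G^{N,f(N)}$. Then: (1) If $f(N)\succ N^2$, then $A_\Gamma$ asymptotically almost surely belongs to $A_{\mathcal F}$. (2) If $f$ is non-decreasing and divergent and $f(N)\prec N^2$, then $A_\Gamma$ asymptotically almost surely does not belong to $A_{\mathcal F}$. (3) If $f(N)=N^2$, then the probability that $A_\Gamma$ belongs to $A_{\mathcal F}$ tends to $e^{-k/2}$ as $N\to\infty$.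
   Context: A defining graph $\Gamma$ is a finite simplicial graph with vertex set $V(\Gamma)$, each edge $e_{ab}$ carrying a coefficient $m_{ab}\in\{2,3,\dots\}$; if $a\neq b$ are not joined by an edge, set $m_{ab}:=\infty$. It defines the Artin group $A_\Gamma=\langle V(\Gamma)\mid \underbrace{aba\cdots}_{m_{ab}}=\underbrace{bab\cdots}_{m_{ab}}$ for every edge $e_{ab}\rangle$. For $N\ge 1$, $M\ge 2$, $\mathcal G^{N,M}$ is the finite set of all defining graphs on a fixed set of $N$ vertices with coefficients in $\{\infty,2,3,\dots,M\}$ (so $\#\mathcal G^{N,M}=M^{N(N-1)/2}$). For a class $\mathcal F$ of defining graphs, the probability that $A_\Gamma$ belongs to $A_{\mathcal F}$, for $\Gamma$ uniform in $\mathcal G^{N,f(N)}$, means $\#(\mathcal F\cap\mathcal G^{N,f(N)})/\#\mathcal G^{N,f(N)}$ (membership is read off the graph: $\Gamma\in\mathcal F$). "Asymptotically almost surely belongs" (resp. "does not belong") means that this probability tends to $1$ (resp. $0$) as $N\to\infty$. $f\succ g$ means $\lim_{N\to\infty}f(N)/g(N)=\infty$, and $f\prec g$ means $g\succ f$. $f$ divergent means $f(N)\to\infty$. *)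

theory Defs
  imports Complex_Main "HOL-Library.Extended_Nat"
begin

(* The edge set of a graph is the domain of its partial labelling, so that a graph is
   determined by its vertices and its labelled edges and can be counted literally. *)
record 'v labelled_graph =
  verts :: "'v set"
  label :: "'v set \<Rightarrow> nat option"

definition edge_set :: "'v labelled_graph \<Rightarrow> 'v set set" where
  "edge_set G = dom (label G)"

definition defining_graph :: "'v labelled_graph \<Rightarrow> bool" where
  "defining_graph G \<longleftrightarrow>
     finite (verts G) \<and>
     (\<forall>e \<in> edge_set G. e \<subseteq> verts G \<and> card e = 2) \<and>
     (\<forall>e \<in> edge_set G. the (label G e) \<ge> 2)"

(* Only meaningful for distinct vertices a, b. *)
definition coeff :: "'v labelled_graph \<Rightarrow> 'v \<Rightarrow> 'v \<Rightarrow> enat" where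
  "coeff G a b = (if {a, b} \<in> edge_set G then enat (the (label G {a, b})) else \<infinity>)"

definition coefficients :: "enat set" where
  "coefficients = insert \<infinity> {enat m | m. 2 \<le> m}"

definition coefficients_upto :: "nat \<Rightarrow> enat set" where
  "coefficients_upto M = insert \<infinity> {enat m | m. 2 \<le> m \<and> m \<le> M}"

(* The fixed set of N vertices is {0, ..., N - 1}. *)
definition graphs :: "nat \<Rightarrow> nat \<Rightarrow> nat labelled_graph set" where
  "graphs N M =
     {G. defining_graph G \<and> verts G = {..<N} \<and>
         (\<forall>a \<in> verts G. \<forall>b \<in> verts G. a \<noteq> b \<longrightarrow> coeff G a b \<in> coefficients_upto M)}"

definition avoiding :: "enat set \<Rightarrow> 'v labelled_graph set" where
  "avoiding S =
     {G. defining_graph G \<and>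
         (\<forall>a \<in> verts G. \<forall>b \<in> verts G. a \<noteq> b \<longrightarrow> coeff G a b \<notin> S)}"

(* The probability that the Artin group of a uniformly random graph in graphs N M belongs
   to the family given by the class F; membership is read off the graph. *)
definition prob_belongs :: "nat labelled_graph set \<Rightarrow> nat \<Rightarrow> nat \<Rightarrow> real" where
  "prob_belongs F N M = real (card (F \<inter> graphs N M)) / real (card (graphs N M))"

definition aas_belongs :: "nat labelled_graph set \<Rightarrow> (nat \<Rightarrow> nat) \<Rightarrow> bool" where
  "aas_belongs F f \<longleftrightarrow> (\<lambda>N. prob_belongs F N (f N)) \<longlonglongrightarrow> 1"

definition aas_not_belongs :: "nat labelled_graph set \<Rightarrow> (nat \<Rightarrow> nat) \<Rightarrow> bool" where
  "aas_not_belongs F f \<longleftrightarrow> (\<lambda>N. prob_belongs F N (f N)) \<longlonglongrightarrow> 0"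

definition dominates :: "(nat \<Rightarrow> nat) \<Rightarrow> (nat \<Rightarrow> nat) \<Rightarrow> bool" (infix "\<succ>" 50) where
  "f \<succ> g \<longleftrightarrow> filterlim (\<lambda>N. real (f N) / real (g N)) at_top sequentially"

abbreviation dominated :: "(nat \<Rightarrow> nat) \<Rightarrow> (nat \<Rightarrow> nat) \<Rightarrow> bool" (infix "\<prec>" 50) where
  "f \<prec> g \<equiv> g \<succ> f"

end

theory Submission
  imports Defs "HOL-Library.FuncSet" "HOL-Real_Asymp.Real_Asymp"
begin

text \<open>
  A defining graph on a fixed set of \<open>N\<close> vertices is the same thing as a free choice of one
  coefficient for each of the \<open>N choose 2\<close> pairs of vertices. If all choices are to lie in a set
  \<open>C\<close>, there are therefore \<open>(card C) ^ (N choose 2)\<close> graphs (\<open>card_graphs_with\<close>). There are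
  \<open>M\<close> coefficients up to \<open>M\<close>, so if \<open>s\<close> of them lie in \<open>S\<close>, the probability that a random graph
  avoids \<open>S\<close> is exactly \<open>(1 - s / M) ^ (N choose 2)\<close> (\<open>prob_avoiding\<close>).

  The exponent grows like \<open>N\<^sup>2 / 2\<close>, so everything depends on the size of \<open>N\<^sup>2 / M\<close>. If it tends to
  \<open>0\<close>, Bernoulli's inequality pushes the probability to \<open>1\<close>. Otherwise \<open>M\<close> tends to infinity in
  the cases considered, so eventually \<open>s = k\<close>. If \<open>N\<^sup>2 / M\<close> tends to infinity, then
  \<open>1 - x \<le> exp (- x)\<close> bounds the probability by \<open>exp (- k (N choose 2) / M)\<close>, which tends to
  \<open>0\<close>; if \<open>M = N\<^sup>2\<close>, the probability is a variant of Euler's limit for \<open>exp (- k / 2)\<close>.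
\<close>

section \<open>Counting graphs with prescribed coefficients\<close>

definition vertex_pairs :: "nat \<Rightarrow> nat set set" where
  "vertex_pairs N = {e. e \<subseteq> {..<N} \<and> card e = 2}"

definition graphs_with :: "nat \<Rightarrow> enat set \<Rightarrow> nat labelled_graph set" where
  "graphs_with N C =
     {G. defining_graph G \<and> verts G = {..<N} \<and>
         (\<forall>a \<in> verts G. \<forall>b \<in> verts G. a \<noteq> b \<longrightarrow> coeff G a b \<in> C)}"

definition pair_coeff :: "'v labelled_graph \<Rightarrow> 'v set \<Rightarrow> enat" where
  "pair_coeff G e = (case label G e of None \<Rightarrow> \<infinity> | Some m \<Rightarrow> enat m)"

definition graph_of_coeffs :: "nat \<Rightarrow> (nat set \<Rightarrow> enat) \<Rightarrow> nat labelled_graph" where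
  "graph_of_coeffs N h =
     \<lparr>verts = {..<N},
      label = (\<lambda>e. if e \<in> vertex_pairs N
                   then (case h e of enat m \<Rightarrow> Some m | \<infinity> \<Rightarrow> None) else None)\<rparr>"

lemma finite_vertex_pairs: "finite (vertex_pairs N)"
  unfolding vertex_pairs_def by (rule finite_subset[of _ "Pow {..<N}"]) auto

lemma card_vertex_pairs: "card (vertex_pairs N) = N choose 2"
  unfolding vertex_pairs_def using n_subsets[of "{..<N}" 2] by simp

lemma coeff_eq_pair_coeff: "coeff G a b = pair_coeff G {a, b}"
  by (auto simp: coeff_def pair_coeff_def edge_set_def split: option.splits)

lemma ball_distinct_pairs_iff:
  "(\<forall>a \<in> {..<N}. \<forall>b \<in> {..<N}. a \<noteq> b \<longrightarrow> P {a, b}) \<longleftrightarrow> (\<forall>e \<in> vertex_pairs N. P e)"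
proof
  assume *: "\<forall>a \<in> {..<N}. \<forall>b \<in> {..<N}. a \<noteq> b \<longrightarrow> P {a, b}"
  show "\<forall>e \<in> vertex_pairs N. P e"
  proof
    fix e assume "e \<in> vertex_pairs N"
    then obtain a b where "e = {a, b}" "a \<noteq> b" "a < N" "b < N"
      by (auto simp: vertex_pairs_def card_2_iff)
    with * show "P e" by auto
  qed
next
  assume "\<forall>e \<in> vertex_pairs N. P e"
  then show "\<forall>a \<in> {..<N}. \<forall>b \<in> {..<N}. a \<noteq> b \<longrightarrow> P {a, b}"
    by (auto simp: vertex_pairs_def)
qed

lemma graphs_with_iff:
  "G \<in> graphs_with N C \<longleftrightarrow>
     defining_graph G \<and> verts G = {..<N} \<and> (\<forall>e \<in> vertex_pairs N. pair_coeff G e \<in> C)"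
  using ball_distinct_pairs_iff[of N "\<lambda>e. pair_coeff G e \<in> C"]
  by (auto simp: graphs_with_def coeff_eq_pair_coeff)

lemma pair_coeff_graph_of_coeffs:
  "e \<in> vertex_pairs N \<Longrightarrow> pair_coeff (graph_of_coeffs N h) e = h e"
  by (simp add: pair_coeff_def graph_of_coeffs_def split: enat.splits)

lemma graph_of_coeffs_pair_coeff:
  assumes "defining_graph G" "verts G = {..<N}"
  shows "graph_of_coeffs N (restrict (pair_coeff G) (vertex_pairs N)) = G"
proof -
  have "label G e = None" if "e \<notin> vertex_pairs N" for e
    using assms that by (auto simp: defining_graph_def vertex_pairs_def edge_set_def)
  then have "(\<lambda>e. if e \<in> vertex_pairs N
      then (case restrict (pair_coeff G) (vertex_pairs N) e of enat m \<Rightarrow> Some m | \<infinity> \<Rightarrow> None)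
      else None) = label G"
    by (auto simp: pair_coeff_def fun_eq_iff split: option.splits)
  with assms show ?thesis by (simp add: graph_of_coeffs_def)
qed

lemma defining_graph_graph_of_coeffs:
  assumes "\<And>e. e \<in> vertex_pairs N \<Longrightarrow> h e \<in> coefficients"
  shows "defining_graph (graph_of_coeffs N h)"
proof -
  let ?G = "graph_of_coeffs N h"
  have "e \<in> vertex_pairs N \<and> 2 \<le> m" if "label ?G e = Some m" for e m
    using that assms[of e]
    by (auto simp: graph_of_coeffs_def coefficients_def split: if_splits enat.splits)
  then have "e \<in> vertex_pairs N \<and> 2 \<le> the (label ?G e)" if "e \<in> edge_set ?G" for e
    using that by (auto simp: edge_set_def)
  moreover have "verts ?G = {..<N}" by (simp add: graph_of_coeffs_def)
  ultimately show ?thesis by (simp add: defining_graph_def vertex_pairs_def)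
qed

text \<open>
  Reading off the coefficient of every pair of vertices is a bijection onto the functions from
  pairs to \<open>C\<close>. Membership in \<open>coefficients\<close> is what makes every such function come from a
  defining graph, whose edge labels must be at least \<open>2\<close>.
\<close>

lemma card_graphs_with:
  assumes "C \<subseteq> coefficients"
  shows "card (graphs_with N C) = card C ^ (N choose 2)"
proof -
  have "bij_betw (\<lambda>G. restrict (pair_coeff G) (vertex_pairs N))
          (graphs_with N C) (vertex_pairs N \<rightarrow>\<^sub>E C)"
  proof (rule bij_betw_byWitness[where f' = "graph_of_coeffs N"])
    show "\<forall>G\<in>graphs_with N C. graph_of_coeffs N (restrict (pair_coeff G) (vertex_pairs N)) = G"
      by (simp add: graphs_with_iff graph_of_coeffs_pair_coeff)
    show "\<forall>h\<in>vertex_pairs N \<rightarrow>\<^sub>E C.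
        restrict (pair_coeff (graph_of_coeffs N h)) (vertex_pairs N) = h"
      by (auto simp: fun_eq_iff pair_coeff_graph_of_coeffs restrict_def PiE_def extensional_def)
    show "(\<lambda>G. restrict (pair_coeff G) (vertex_pairs N)) ` graphs_with N C
        \<subseteq> vertex_pairs N \<rightarrow>\<^sub>E C"
      by (auto simp: graphs_with_iff)
    show "graph_of_coeffs N ` (vertex_pairs N \<rightarrow>\<^sub>E C) \<subseteq> graphs_with N C"
    proof (rule image_subsetI)
      fix h assume h: "h \<in> vertex_pairs N \<rightarrow>\<^sub>E C"
      then have "\<And>e. e \<in> vertex_pairs N \<Longrightarrow> h e \<in> coefficients"
        using assms by blast
      moreover have "\<forall>e \<in> vertex_pairs N. pair_coeff (graph_of_coeffs N h) e \<in> C"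
        using h by (auto simp: pair_coeff_graph_of_coeffs)
      ultimately show "graph_of_coeffs N h \<in> graphs_with N C"
        by (simp add: graphs_with_iff defining_graph_graph_of_coeffs)
          (simp add: graph_of_coeffs_def)
    qed
  qed
  then have "card (graphs_with N C) = card (vertex_pairs N \<rightarrow>\<^sub>E C)"
    by (rule bij_betw_same_card)
  also have "\<dots> = card C ^ (N choose 2)"
    by (simp add: card_PiE finite_vertex_pairs card_vertex_pairs)
  finally show ?thesis .
qed

section \<open>The exact probability\<close>

lemma coefficients_upto_eq: "coefficients_upto M = insert \<infinity> (enat ` {2..M})"
  by (auto simp: coefficients_upto_def)

lemma finite_coefficients_upto: "finite (coefficients_upto M)"
  by (simp add: coefficients_upto_eq)

lemma coefficients_upto_subset: "coefficients_upto M \<subseteq> coefficients"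
  by (auto simp: coefficients_upto_def coefficients_def)

text \<open>The coefficient \<open>\<infinity>\<close> takes the place of the missing \<open>1\<close> among \<open>1, \<dots>, M\<close>.\<close>

lemma card_coefficients_upto:
  assumes "M \<ge> 1"
  shows "card (coefficients_upto M) = M"
proof -
  have "card (enat ` {2..M}) = M - 1"
    by (subst card_image) (auto simp: inj_on_def)
  moreover have "\<infinity> \<notin> enat ` {2..M}" by auto
  ultimately show ?thesis using assms by (simp add: coefficients_upto_eq)
qed

lemma prob_avoiding:
  assumes "M \<ge> 1"
  shows "prob_belongs (avoiding S) N M =
           (1 - real (card (S \<inter> coefficients_upto M)) / real M) ^ (N choose 2)"
proof -
  let ?C = "coefficients_upto M"
  have all: "graphs N M = graphs_with N ?C"
    by (simp add: graphs_def graphs_with_def)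
  have avoid: "avoiding S \<inter> graphs N M = graphs_with N (?C - S)"
    by (auto simp: graphs_def graphs_with_def avoiding_def)
  have le: "card (S \<inter> ?C) \<le> M"
    using card_mono[OF finite_coefficients_upto, of "S \<inter> ?C" M] assms
    by (simp add: card_coefficients_upto)
  have "card (?C - S) = M - card (S \<inter> ?C)"
    using card_Diff_subset_Int[of ?C S] assms
    by (simp add: finite_coefficients_upto card_coefficients_upto Int_commute)
  then have "real (card (?C - S)) / real M = 1 - real (card (S \<inter> ?C)) / real M"
    using le assms by (simp add: of_nat_diff diff_divide_distrib)
  moreover have "prob_belongs (avoiding S) N M = (real (card (?C - S)) / real M) ^ (N choose 2)"
    unfolding prob_belongs_def avoid unfolding all
    using assms coefficients_upto_subset[of M]
    by (subst (1 2) card_graphs_with) (auto simp: card_coefficients_upto power_divide)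
  ultimately show ?thesis by simp
qed

lemma eventually_subset_coefficients_upto:
  assumes "finite S" "S \<subseteq> coefficients"
  shows "\<forall>\<^sub>F M in sequentially. S \<subseteq> coefficients_upto M"
proof -
  have "\<forall>\<^sub>F M in sequentially. c \<in> coefficients_upto M" if "c \<in> S" for c
  proof -
    from that assms(2) consider "c = \<infinity>" | m where "c = enat m" "2 \<le> m"
      by (auto simp: coefficients_def)
    then show ?thesis
    proof cases
      case 2
      show ?thesis
        using eventually_ge_at_top[of m] by eventually_elim (use 2 in \<open>simp add: coefficients_upto_def\<close>)
    qed (simp add: coefficients_upto_def)
  qed
  then have "\<forall>\<^sub>F M in sequentially. \<forall>c\<in>S. c \<in> coefficients_upto M"
    using assms(1) by (simp add: eventually_ball_finite)
  then show ?thesis by (simp only: subset_eq)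
qed

lemma eventually_prob_avoiding:
  assumes "finite S" "S \<subseteq> coefficients" "filterlim f at_top sequentially"
  shows "\<forall>\<^sub>F N in sequentially. f N \<ge> card S \<and> f N \<ge> 1 \<and>
           prob_belongs (avoiding S) N (f N) = (1 - real (card S) / real (f N)) ^ (N choose 2)"
proof -
  have "\<forall>\<^sub>F M in sequentially. S \<subseteq> coefficients_upto M \<and> M \<ge> card S \<and> M \<ge> 1"
    by (intro eventually_conj eventually_subset_coefficients_upto assms eventually_ge_at_top)
  then have "\<forall>\<^sub>F N in sequentially. S \<subseteq> coefficients_upto (f N) \<and> f N \<ge> card S \<and> f N \<ge> 1"
    by (rule eventually_compose_filterlim[OF _ assms(3)])
  then show ?thesis
    by eventually_elim (simp add: prob_avoiding Int_absorb2)
qed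

section \<open>The three regimes\<close>

lemma real_choose_two: "real (N choose 2) = real N * (real N - 1) / 2"
proof (cases N)
  case (Suc n)
  have "even (N * (N - 1))" by (cases "even N") auto
  then have "real (N choose 2) = real (N * (N - 1)) / 2"
    unfolding choose_two using real_of_nat_div by fastforce
  then show ?thesis using Suc by (simp add: algebra_simps)
qed simp

lemma aas_belongs_avoiding:
  assumes "finite S" "f \<succ> (\<lambda>N. N ^ 2)"
  shows "aas_belongs (avoiding S) f"
  unfolding aas_belongs_def
proof (rule tendsto_sandwich)
  have lim: "filterlim (\<lambda>N. real (f N) / real (N ^ 2)) at_top sequentially"
    using assms(2) by (simp add: dominates_def)
  \<comment> \<open>Division by zero makes the quotient vanish when \<open>N = 0\<close> or \<open>f N = 0\<close>, so its positivity
    rules out both.\<close>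
  have "\<forall>\<^sub>F N in sequentially. real (f N) / real (N ^ 2) > 0"
    using lim by (simp add: filterlim_at_top_dense)
  then have pos: "\<forall>\<^sub>F N in sequentially. f N \<ge> 1"
    by eventually_elim (auto simp: zero_less_divide_iff)
  have bounds: "1 - real (card S) * inverse (real (f N) / real (N ^ 2))
          \<le> prob_belongs (avoiding S) N (f N) \<and> prob_belongs (avoiding S) N (f N) \<le> 1"
    if M: "f N \<ge> 1" for N
  proof -
    let ?s = "card (S \<inter> coefficients_upto (f N))"
    let ?x = "real ?s / real (f N)"
    have "?s \<le> card (coefficients_upto (f N))"
      by (rule card_mono) (auto simp: finite_coefficients_upto)
    then have x: "0 \<le> ?x" "?x \<le> 1" using M by (auto simp: card_coefficients_upto)
    have "?s \<le> card S" by (rule card_mono) (auto simp: assms)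
    then have "real (N choose 2) * ?x \<le> real (N ^ 2) * (real (card S) / real (f N))"
      by (intro mult_mono divide_right_mono)
        (auto simp: real_choose_two power2_eq_square algebra_simps)
    moreover have "1 - real (N choose 2) * ?x \<le> (1 - ?x) ^ (N choose 2)"
      using x Bernoulli_inequality[of "- ?x" "N choose 2"] by simp
    moreover have "(1 - ?x) ^ (N choose 2) \<le> 1"
      using x by (intro power_le_one) auto
    moreover have "real (card S) * inverse (real (f N) / real (N ^ 2))
        = real (N ^ 2) * (real (card S) / real (f N))"
      by (simp add: field_simps)
    ultimately show ?thesis
      unfolding prob_avoiding[OF M] by (intro conjI) linarith+
  qed
  show "\<forall>\<^sub>F N in sequentially. 1 - real (card S) * inverse (real (f N) / real (N ^ 2))
          \<le> prob_belongs (avoiding S) N (f N)"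
    using pos by eventually_elim (use bounds in blast)
  show "\<forall>\<^sub>F N in sequentially. prob_belongs (avoiding S) N (f N) \<le> 1"
    using pos by eventually_elim (use bounds in blast)
  have "(\<lambda>N. inverse (real (f N) / real (N ^ 2))) \<longlonglongrightarrow> 0"
    by (rule tendsto_inverse_0_at_top[OF lim])
  then have "(\<lambda>N. 1 - real (card S) * inverse (real (f N) / real (N ^ 2)))
      \<longlonglongrightarrow> 1 - real (card S) * 0"
    by (intro tendsto_intros)
  then show "(\<lambda>N. 1 - real (card S) * inverse (real (f N) / real (N ^ 2))) \<longlonglongrightarrow> 1"
    by simp
qed simp

lemma aas_not_belongs_avoiding:
  assumes "finite S" "S \<noteq> {}" "S \<subseteq> coefficients"
    and "filterlim f at_top sequentially" "f \<prec> (\<lambda>N. N ^ 2)"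
  shows "aas_not_belongs (avoiding S) f"
  unfolding aas_not_belongs_def
proof (rule tendsto_sandwich)
  show "\<forall>\<^sub>F N in sequentially. 0 \<le> prob_belongs (avoiding S) N (f N)"
    by (simp add: prob_belongs_def)
  let ?k = "real (card S)"
  let ?B = "\<lambda>N. exp (- (?k / 4 * (real (N ^ 2) / real (f N))))"
  have k: "?k > 0" using assms by (simp add: card_gt_0_iff)
  show "\<forall>\<^sub>F N in sequentially. prob_belongs (avoiding S) N (f N) \<le> ?B N"
    using eventually_prob_avoiding[OF assms(1,3,4)] eventually_ge_at_top[of 2]
  proof eventually_elim
    case (elim N)
    let ?x = "?k / real (f N)"
    have "(1 - ?x) ^ (N choose 2) \<le> exp (- ?x) ^ (N choose 2)"
      using elim exp_ge_add_one_self[of "- ?x"] by (intro power_mono) auto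
    also have "\<dots> = exp (- (real (N choose 2) * ?x))"
      by (simp flip: exp_of_nat_mult)
    also have "\<dots> \<le> ?B N"
    proof -
      \<comment> \<open>For \<open>N \<ge> 2\<close> at least a quarter of the \<open>N\<^sup>2\<close> ordered pairs survives in \<open>N choose 2\<close>.\<close>
      have "real N * 2 \<le> real N * real N" using elim by (intro mult_left_mono) auto
      then have "real (N ^ 2) / 4 \<le> real (N choose 2)"
        by (simp add: real_choose_two power2_eq_square field_simps)
      then have "real (N ^ 2) / 4 * ?x \<le> real (N choose 2) * ?x"
        by (intro mult_right_mono) auto
      then show ?thesis by (simp add: field_simps)
    qed
    finally show ?case using elim by simp
  qed
  have "filterlim (\<lambda>N. ?k / 4 * (real (N ^ 2) / real (f N))) at_top sequentially"
    using assms(5) k unfolding dominates_def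
    by (intro filterlim_tendsto_pos_mult_at_top[OF tendsto_const]) auto
  then have "filterlim (\<lambda>N. - (?k / 4 * (real (N ^ 2) / real (f N)))) at_bot sequentially"
    by (simp add: filterlim_uminus_at_bot)
  then show "?B \<longlonglongrightarrow> 0"
    by (rule filterlim_compose[OF exp_at_bot])
qed simp

lemma power_choose_two_tendsto:
  assumes "c > 0"
  shows "(\<lambda>N. (1 - c / real (N ^ 2)) ^ (N choose 2)) \<longlonglongrightarrow> exp (- c / 2)"
proof (rule Lim_transform_eventually)
  show "(\<lambda>N. exp (real N * (real N - 1) / 2 * ln (1 - c / real N ^ 2))) \<longlonglongrightarrow> exp (- c / 2)"
    using assms by real_asymp
  have "\<forall>\<^sub>F N in sequentially. 1 - c / real N ^ 2 > 0"
    using assms by real_asymp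
  then show "\<forall>\<^sub>F N in sequentially. exp (real N * (real N - 1) / 2 * ln (1 - c / real N ^ 2))
      = (1 - c / real (N ^ 2)) ^ (N choose 2)"
    by eventually_elim (simp add: exp_of_nat_mult flip: real_choose_two)
qed

lemma prob_avoiding_square_tendsto:
  assumes "finite S" "S \<noteq> {}" "S \<subseteq> coefficients" and f: "\<forall>N \<ge> 1. f N = N ^ 2"
  shows "(\<lambda>N. prob_belongs (avoiding S) N (f N)) \<longlonglongrightarrow> exp (- real (card S) / 2)"
proof (rule Lim_transform_eventually)
  have f': "\<forall>\<^sub>F N in sequentially. f N = N ^ 2"
    using f by (auto simp: eventually_sequentially)
  have "filterlim (\<lambda>N::nat. N ^ 2) at_top sequentially"
    by (rule filterlim_at_top_mono[OF filterlim_ident]) (simp add: power2_eq_square)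
  then have "filterlim f at_top sequentially"
    using filterlim_cong[OF refl refl f'] by blast
  from eventually_prob_avoiding[OF assms(1,3) this] f'
  show "\<forall>\<^sub>F N in sequentially. (1 - real (card S) / real (N ^ 2)) ^ (N choose 2)
      = prob_belongs (avoiding S) N (f N)"
    by eventually_elim auto
  show "(\<lambda>N. (1 - real (card S) / real (N ^ 2)) ^ (N choose 2)) \<longlonglongrightarrow> exp (- real (card S) / 2)"
    using assms by (intro power_choose_two_tendsto) (simp add: card_gt_0_iff)
qed

theorem theorem1p2:
  fixes k :: nat and S :: "enat set" and f :: "nat \<Rightarrow> nat"
  assumes "k \<ge> 1"
    and "S \<subseteq> coefficients" and "finite S" and "card S = k"
  shows "(f \<succ> (\<lambda>N. N ^ 2) \<longrightarrow> aas_belongs (avoiding S) f) \<and>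
    (mono_on {1..} f \<and> filterlim f at_top sequentially \<and> f \<prec> (\<lambda>N. N ^ 2)
       \<longrightarrow> aas_not_belongs (avoiding S) f) \<and>
    ((\<forall>N \<ge> 1. f N = N ^ 2)
       \<longrightarrow> (\<lambda>N. prob_belongs (avoiding S) N (f N)) \<longlonglongrightarrow> exp (- real k / 2))"
proof -
  have "S \<noteq> {}" using assms by auto
  then show ?thesis
    using assms aas_belongs_avoiding aas_not_belongs_avoiding prob_avoiding_square_tendsto
    by blast
qed

end
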